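(* Let $N\ge1$, let $W_0$ be an $N\times N$ nonnegative matrix without null rows and without null columns, and let $(W_t)_t$ be the normalized sequence generated from $W_0$ by a sequence of normalizing operators $(T^{(k_t)}_{l_t})_{t\ge1}$, where $k_t\in\{r,c\}$ and $l_t\in\{1,\ldots,N\}$. Let \[ \mathcal{K}_0=\{(k,l)\in\{r,c\}\times\{1,\ldots,N\}\colon k_t=k\text{ and }l_t=l\text{ for infinitely many }t\}. \] If $W_0$ has a positive $\mathcal{K}_0$-diagonal, then every limit point $A$ of the sequence $(W_t)_t$ (i.e. every limit of a convergent subsequence) is diagonally equivalent to the $\mathcal{K}_0$-positive supported part $W_0^{\mathcal{K}_0}$ of $W_0$: there exist diagonal matrices $D_1,D_2$ with positive diagonal entries such that $A=D_1W_0^{\mathcal{K}_0}D_2$.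
   Context: Normalizing operators, acting on $N\times N$ nonnegative matrices without null rows or columns: $T^{(r)}_{l}(W)$ is the matrix obtained from $W$ by dividing each entry of the $l$-th row by the $l$-th row sum $\sum_k W_{lk}$, leaving all other entries unchanged; $T^{(c)}_{l}(W)$ is obtained from $W$ by dividing each entry of the $l$-th column by the $l$-th column sum $\sum_k W_{kl}$, leaving all other entries unchanged. The normalized sequence generated by $(T^{(k_t)}_{l_t})_{t\ge1}$ from $W_0$ is defined inductively by $W_t=T^{(k_t)}_{l_t}(W_{t-1})$, $t\ge1$. The sequence $(k_t,l_t)_t$ is arbitrary. For $\mathcal{K}\subseteq\{r,c\}\times\{1,\ldots,N\}$, a $\mathcal{K}$-diagonal is a set $D\subseteq\{1,\ldots,N\}^2$ of matrix positions such that for every $(r,l)\in\mathcal{K}$ exactly one element of $D$ lies in the $l$-th row, and for every $(c,l)\in\mathcal{K}$ exactly one element of $D$ lies in the $l$-th column (no constraint for rows and columns not in $\mathcal{K}$). A $\mathcal{K}$-diagonal $D$ is positive for $W$ if $W_{ij}>0$ for all $(i,j)\in D$. The $\mathcal{K}$-positive supported part of a nonnegative matrix $W$ is the matrix $W^{\mathcal{K}}$ with $(W^{\mathcal{K}})_{ij}=W_{ij}$ if $(i,j)$ lies on some positive $\mathcal{K}$-diagonal of $W$, and $(W^{\mathcal{K}})_{ij}=0$ otherwise. *)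

theory Defs
  imports "HOL-Analysis.Analysis"
begin

text \<open>
  \<open>N \<times> N\<close> matrices are rendered as \<open>real ^ 'n ^ 'n\<close>; the finite (hence nonempty) index type
  \<open>'n\<close> stands for \<open>{1, ..., N}\<close>. The entry in row \<open>i\<close> and column \<open>j\<close> is \<open>W $ i $ j\<close>.
\<close>

datatype kind = Row | Col

definition nonneg_matrix :: "real ^ 'n ^ 'm \<Rightarrow> bool" where
  "nonneg_matrix W \<longleftrightarrow> (\<forall>i j. 0 \<le> W $ i $ j)"

definition no_null_lines :: "real ^ 'n ^ 'm \<Rightarrow> bool" where
  "no_null_lines W \<longleftrightarrow> (\<forall>i. row i W \<noteq> 0) \<and> (\<forall>j. column j W \<noteq> 0)"

definition row_normalize :: "'n::finite \<Rightarrow> real ^ 'n ^ 'n \<Rightarrow> real ^ 'n ^ 'n" where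
  "row_normalize l W = (\<chi> i j. if i = l then W $ i $ j / (\<Sum>k\<in>UNIV. W $ l $ k) else W $ i $ j)"

definition column_normalize :: "'n::finite \<Rightarrow> real ^ 'n ^ 'n \<Rightarrow> real ^ 'n ^ 'n" where
  "column_normalize l W = (\<chi> i j. if j = l then W $ i $ j / (\<Sum>k\<in>UNIV. W $ k $ l) else W $ i $ j)"

fun normalizing_op :: "kind \<Rightarrow> 'n::finite \<Rightarrow> real ^ 'n ^ 'n \<Rightarrow> real ^ 'n ^ 'n" where
  "normalizing_op Row l W = row_normalize l W"
| "normalizing_op Col l W = column_normalize l W"

text \<open>The operators are indexed by \<open>t \<ge> 1\<close>: the values \<open>k 0\<close> and \<open>l 0\<close> are never used.\<close>

primrec normalized_seq ::
  "(nat \<Rightarrow> kind) \<Rightarrow> (nat \<Rightarrow> 'n::finite) \<Rightarrow> real ^ 'n ^ 'n \<Rightarrow> nat \<Rightarrow> real ^ 'n ^ 'n" where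
  "normalized_seq k l W0 0 = W0"
| "normalized_seq k l W0 (Suc t) =
     normalizing_op (k (Suc t)) (l (Suc t)) (normalized_seq k l W0 t)"

definition infinitely_often :: "(nat \<Rightarrow> kind) \<Rightarrow> (nat \<Rightarrow> 'n) \<Rightarrow> (kind \<times> 'n) set" where
  "infinitely_often k l = {(a, b). infinite {t. 1 \<le> t \<and> k t = a \<and> l t = b}}"

definition K_diagonal :: "(kind \<times> 'n) set \<Rightarrow> ('n \<times> 'n) set \<Rightarrow> bool" where
  "K_diagonal K D \<longleftrightarrow>
     (\<forall>l. (Row, l) \<in> K \<longrightarrow> (\<exists>!p. p \<in> D \<and> fst p = l)) \<and>
     (\<forall>l. (Col, l) \<in> K \<longrightarrow> (\<exists>!p. p \<in> D \<and> snd p = l))"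

definition positive_for :: "('n \<times> 'n) set \<Rightarrow> real ^ 'n ^ 'n \<Rightarrow> bool" where
  "positive_for D W \<longleftrightarrow> (\<forall>(i, j)\<in>D. W $ i $ j > 0)"

definition positive_supported_part ::
  "(kind \<times> 'n) set \<Rightarrow> real ^ 'n ^ 'n \<Rightarrow> real ^ 'n ^ 'n" where
  "positive_supported_part K W =
     (\<chi> i j. if \<exists>D. K_diagonal K D \<and> positive_for D W \<and> (i, j) \<in> D then W $ i $ j else 0)"

definition positive_diagonal_matrix :: "real ^ 'n ^ 'n \<Rightarrow> bool" where
  "positive_diagonal_matrix D \<longleftrightarrow>
     (\<forall>i j. i \<noteq> j \<longrightarrow> D $ i $ j = 0) \<and> (\<forall>i. D $ i $ i > 0)"

definition diagonally_equivalent :: "real ^ 'n::finite ^ 'n \<Rightarrow> real ^ 'n ^ 'n \<Rightarrow> bool" where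
  "diagonally_equivalent A B \<longleftrightarrow>
     (\<exists>D1 D2. positive_diagonal_matrix D1 \<and> positive_diagonal_matrix D2 \<and> A = D1 ** B ** D2)"

definition seq_limit_point :: "(nat \<Rightarrow> 'a::topological_space) \<Rightarrow> 'a \<Rightarrow> bool" where
  "seq_limit_point X a \<longleftrightarrow> (\<exists>s. strict_mono s \<and> (X \<circ> s) \<longlonglongrightarrow> a)"

end

theory Submission
  imports Defs
begin

text \<open>
  Regard a matrix as a function \<open>w\<close> on positions. For a nonnegative \<open>z\<close> whose support lies in that
  of \<open>w\<close>, normalizing a line on which \<open>z\<close> sums to 1 and \<open>w\<close> sums to \<open>s\<close> changes
  \<open>energy z w = (\<Sum>p. w p - z p * ln (w p))\<close> by exactly \<open>- (s - 1 - ln s) \<le> 0\<close>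
  (\<open>energy_normalize\<close>), and \<open>energy z\<close> is smallest at \<open>z\<close> itself (\<open>energy_gap\<close>); up to a constant
  it is the Kullback-Leibler divergence of \<open>z\<close> from \<open>w\<close>. From some time on only lines in
  \<open>K\<close>, those normalized infinitely often, are used, and the proof uses two kinds of \<open>z\<close>.

  \<^item> The indicator of a positive \<open>K\<close>-diagonal sums to 1 on every line of \<open>K\<close>. Its energy decreases and
    is bounded below, so the drops are summable: the sums by which the process divides tend to 1
    (\<open>line_sums_tendsto_1\<close>), and entries on the diagonal stay away from 0
    (\<open>entries_bounded_below\<close>).
  \<^item> The limit point \<open>A\<close> itself. As long as the process only uses lines on which \<open>A\<close> sums to 1, it cannot
    move away from \<open>A\<close>. So if \<open>A\<close> missed the sum 1 on some line of \<open>K\<close>, then at infinitely many times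
    such a line would be normalized while the matrix is close to \<open>A\<close>, and the divisors
    could not tend to 1. Hence \<open>A\<close> sums to 1 on all of \<open>K\<close> (\<open>limit_point_line_sum\<close>).

  Every positive position of a nonnegative matrix with these line sums lies on a \<open>K\<close>-diagonal in
  its support, by a form of Birkhoff's theorem (\<open>positive_entry_on_K_diagonal\<close>). Together with the
  lower bound, \<open>A\<close> is positive exactly where the \<open>K\<close>-positive supported part of \<open>W\<^sub>0\<close> is.

  Finally every \<open>W\<^sub>t\<close> is a diagonal scaling of \<open>W\<^sub>0\<close>. The scaling factors need not converge, but the
  logarithms of their products range over a linear subspace of a finite-dimensional space,
  which is closed; so on the positions where \<open>A\<close> is positive, it is again a diagonal scaling
  of \<open>W\<^sub>0\<close> (\<open>scaling_limit\<close>).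
\<close>

section \<open>Normalization of one line and the energy functional\<close>

definition normalize_on :: "'p set \<Rightarrow> ('p \<Rightarrow> real) \<Rightarrow> 'p \<Rightarrow> real" where
  "normalize_on S w p = (if p \<in> S then w p / sum w S else w p)"

definition energy :: "('p::finite \<Rightarrow> real) \<Rightarrow> ('p \<Rightarrow> real) \<Rightarrow> real" where
  "energy z w = (\<Sum>p\<in>UNIV. w p - z p * ln (w p))"

text \<open>
  The linear part of the energy changes by \<open>1 - s\<close>; dividing by \<open>s\<close> adds \<open>ln s\<close> to the logarithmic
  part with total weight \<open>sum z S = 1\<close>. Where \<open>z\<close> vanishes the logarithm is multiplied by 0, so
  zero entries of \<open>w\<close> do no harm.
\<close>

lemma energy_normalize:
  fixes z w :: "'p::finite \<Rightarrow> real"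
  assumes z: "sum z S = 1" and s: "sum w S > 0" and supp: "\<And>p. z p \<noteq> 0 \<Longrightarrow> w p > 0"
  shows "energy z (normalize_on S w) = energy z w - (sum w S - 1 - ln (sum w S))"
proof -
  let ?s = "sum w S"
  have eq: "normalize_on S w p - z p * ln (normalize_on S w p)
      = (w p - z p * ln (w p)) + (if p \<in> S then w p / ?s - w p + z p * ln ?s else 0)" for p
  proof (cases "z p = 0")
    case False
    then show ?thesis
      using supp[OF False] s by (simp add: normalize_on_def ln_div algebra_simps)
  qed (simp add: normalize_on_def)
  have "(\<Sum>p\<in>UNIV. if p \<in> S then w p / ?s - w p + z p * ln ?s else 0)
      = (\<Sum>p\<in>S. w p / ?s - w p + z p * ln ?s)"
    by (simp add: sum.If_cases)
  also have "\<dots> = ?s / ?s - ?s + sum z S * ln ?s"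
    by (simp add: sum.distrib sum_subtractf flip: sum_divide_distrib sum_distrib_right)
  finally show ?thesis
    unfolding energy_def eq sum.distrib using z s by simp
qed

text \<open>
  Apply \<open>ln u \<le> u - 1\<close> to \<open>u = sqrt (w / z)\<close> rather than to \<open>w / z\<close>: this keeps a squared distance
  as remainder, so that a small gap forces \<open>w\<close> to be close to \<open>z\<close>, also for \<open>z = 0\<close>. With \<open>z = 1\<close> it
  shows that \<open>w - 1 - ln w\<close> can only be small if \<open>w\<close> is close to 1.
\<close>

lemma entropy_gap:
  fixes z w :: real
  assumes "z \<ge> 0" "w \<ge> 0" "z \<noteq> 0 \<Longrightarrow> w > 0"
  shows "z - z * ln z + (sqrt w - sqrt z)\<^sup>2 \<le> w - z * ln w"
proof (cases "z = 0")
  case False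
  then have pos: "z > 0" "w > 0" using assms by auto
  have "ln (sqrt (w / z)) \<le> sqrt (w / z) - 1"
    using pos by (intro ln_le_minus_one) simp
  then have "ln w - ln z \<le> 2 * (sqrt (w / z) - 1)"
    using pos by (simp add: ln_sqrt ln_div)
  then have "z * (ln w - ln z) \<le> z * (2 * (sqrt (w / z) - 1))"
    using pos by (intro mult_left_mono) auto
  also have "\<dots> = 2 * (z * sqrt (w / z)) - 2 * z" by (simp add: algebra_simps)
  also have "z * sqrt (w / z) = sqrt w * sqrt z"
    using pos by (simp add: real_sqrt_divide field_simps)
  finally show ?thesis
    using pos by (simp add: power2_diff algebra_simps)
qed (use assms in simp)

lemma energy_gap:
  fixes z w :: "'p::finite \<Rightarrow> real"
  assumes "\<And>p. z p \<ge> 0" "\<And>p. w p \<ge> 0" "\<And>p. z p \<noteq> 0 \<Longrightarrow> w p > 0"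
  shows "energy z z + (\<Sum>p\<in>UNIV. (sqrt (w p) - sqrt (z p))\<^sup>2) \<le> energy z w"
  unfolding energy_def sum.distrib[symmetric] by (intro sum_mono entropy_gap assms)

lemma energy_normalize_le:
  fixes z w :: "'p::finite \<Rightarrow> real"
  assumes "sum z S = 1" and "sum w S > 0" and "\<And>p. z p \<noteq> 0 \<Longrightarrow> w p > 0"
  shows "energy z (normalize_on S w) \<le> energy z w"
  using energy_normalize[OF assms] ln_le_minus_one[OF assms(2)] by simp

section \<open>Sequences of normalizations\<close>

text \<open>Lines are abstracted to sets of positions, which treats rows and columns alike.\<close>

locale normalizing_sequence =
  fixes w :: "nat \<Rightarrow> 'p::finite \<Rightarrow> real" and S :: "nat \<Rightarrow> 'p set"
  assumes step: "\<And>t. w (Suc t) = normalize_on (S t) (w t)"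
    and nonneg: "\<And>t p. w t p \<ge> 0"
    and line_pos: "\<And>t. sum (w t) (S t) > 0"
begin

lemma energy_antimono:
  fixes z :: "'p \<Rightarrow> real"
  assumes "\<And>t p. z p \<noteq> 0 \<Longrightarrow> w t p > 0"
    and "\<And>r. m \<le> r \<Longrightarrow> r < t \<Longrightarrow> sum z (S r) = 1" and "m \<le> t"
  shows "energy z (w t) \<le> energy z (w m)"
  using assms(3) assms(2)
proof (induction t rule: dec_induct)
  case (step n)
  have "energy z (w (Suc n)) \<le> energy z (w n)"
    unfolding normalizing_sequence.step[OF normalizing_sequence_axioms]
    using step line_pos assms(1) by (intro energy_normalize_le) auto
  with step show ?case by force
qed simp

text \<open>
  The energy is decreasing from time \<open>T\<close> on and bounded below by \<open>energy z z\<close>, so its decrements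
  \<open>s - 1 - ln s\<close> tend to 0, and they dominate \<open>(sqrt s - 1)\<^sup>2\<close>.
\<close>

lemma line_sums_tendsto_1:
  fixes z :: "'p \<Rightarrow> real"
  assumes z: "\<And>p. z p \<ge> 0" and supp: "\<And>t p. z p \<noteq> 0 \<Longrightarrow> w t p > 0"
    and one: "\<And>t. T \<le> t \<Longrightarrow> sum z (S t) = 1"
  shows "(\<lambda>t. sum (w t) (S t)) \<longlonglongrightarrow> 1"
proof -
  define e where "e t = energy z (w (t + T))" for t
  let ?s = "\<lambda>t. sum (w (t + T)) (S (t + T))"
  have drop: "e t - e (Suc t) = ?s t - 1 - ln (?s t)" for t
    using energy_normalize[OF one line_pos supp, of "t + T"] by (simp add: e_def step)
  have "decseq e"
    unfolding decseq_Suc_iff using drop ln_le_minus_one[OF line_pos] by (smt (verit))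
  moreover have "energy z z \<le> e t" for t
    using energy_gap[of z "w (t + T)", OF z nonneg supp]
    unfolding e_def by (smt (verit) sum_nonneg zero_le_power2)
  ultimately obtain c where c: "e \<longlonglongrightarrow> c"
    using decseq_convergent by blast
  have "(\<lambda>t. e t - e (Suc t)) \<longlonglongrightarrow> c - c"
    by (intro tendsto_diff c LIMSEQ_Suc)
  then have gap0: "(\<lambda>t. ?s t - 1 - ln (?s t)) \<longlonglongrightarrow> 0"
    unfolding drop by simp
  have "(\<lambda>t. (sqrt (?s t) - 1)\<^sup>2) \<longlonglongrightarrow> 0"
  proof (rule tendsto_sandwich[OF _ _ tendsto_const gap0])
    show "\<forall>\<^sub>F t in sequentially. (sqrt (?s t) - 1)\<^sup>2 \<le> ?s t - 1 - ln (?s t)"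
    proof (intro always_eventually allI)
      show "(sqrt (?s t) - 1)\<^sup>2 \<le> ?s t - 1 - ln (?s t)" for t
        using entropy_gap[of 1 "?s t"] line_pos[of "t + T"] by simp
    qed
  qed simp
  then have "(\<lambda>t. sqrt ((sqrt (?s t) - 1)\<^sup>2)) \<longlonglongrightarrow> sqrt 0"
    by (rule tendsto_real_sqrt)
  then have "(\<lambda>t. sqrt (?s t) - 1) \<longlonglongrightarrow> 0"
    by (simp add: tendsto_rabs_zero_iff)
  then have "(\<lambda>t. (sqrt (?s t) - 1 + 1)\<^sup>2) \<longlonglongrightarrow> (0 + 1)\<^sup>2"
    by (intro tendsto_intros)
  then have "?s \<longlonglongrightarrow> 1"
    using line_pos by (simp add: less_imp_le)
  then show ?thesis
    by (rule LIMSEQ_offset)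
qed

text \<open>
  Each summand of the energy is bounded below, and their sum is bounded above by the energy at
  time \<open>T\<close>. So \<open>- z q * ln (w t q)\<close> is bounded above.
\<close>

lemma entries_bounded_below:
  fixes z :: "'p \<Rightarrow> real"
  assumes z: "\<And>p. z p \<ge> 0" and supp: "\<And>t p. z p \<noteq> 0 \<Longrightarrow> w t p > 0"
    and one: "\<And>t. T \<le> t \<Longrightarrow> sum z (S t) = 1" and q: "z q > 0"
  shows "\<exists>c>0. \<forall>t\<ge>T. c \<le> w t q"
proof (intro exI conjI allI impI)
  define M where "M = energy z (w T) - (\<Sum>p\<in>UNIV - {q}. z p - z p * ln (z p))"
  show "exp (- (M / z q)) > 0" by simp
  fix t assume t: "T \<le> t"
  have "energy z (w t) \<le> energy z (w T)"
    using energy_antimono[OF supp _ t] one by blast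
  moreover have "energy z (w t)
      = w t q - z q * ln (w t q) + (\<Sum>p\<in>UNIV - {q}. w t p - z p * ln (w t p))"
    unfolding energy_def by (subst sum.remove[of UNIV q]) auto
  moreover have "(\<Sum>p\<in>UNIV - {q}. z p - z p * ln (z p))
      \<le> (\<Sum>p\<in>UNIV - {q}. w t p - z p * ln (w t p))"
  proof (rule sum_mono)
    show "z p - z p * ln (z p) \<le> w t p - z p * ln (w t p)" for p
      using entropy_gap[of "z p" "w t p", OF z nonneg supp] by (smt (verit) zero_le_power2)
  qed
  ultimately have "- M \<le> z q * ln (w t q)"
    using nonneg[of t q] unfolding M_def by linarith
  then have "- (M / z q) \<le> ln (w t q)"
    using q by (simp add: field_simps)
  moreover have "w t q > 0" using supp q by simp
  ultimately show "exp (- (M / z q)) \<le> w t q"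
    by (simp add: ln_ge_iff)
qed

text \<open>
  The argument of Fejer monotonicity, with \<open>a\<close> as reference point although it is not yet known to
  satisfy all constraints. Let \<open>r n\<close> be the first time from \<open>s n\<close> on at which the line to be normalized has
  \<open>a\<close>-sum different from 1. Up to \<open>r n\<close> the energy relative to \<open>a\<close> does not increase, so
  \<open>w (r n)\<close> still tends to \<open>a\<close>, and the \<open>a\<close>-sums of these lines would have to tend to 1.
\<close>

lemma limit_point_line_sum:
  fixes a :: "'p \<Rightarrow> real"
  assumes s: "strict_mono s" and lim: "\<And>p. (\<lambda>n. w (s n) p) \<longlonglongrightarrow> a p"
    and supp: "\<And>t p. a p \<noteq> 0 \<Longrightarrow> w t p > 0"
    and to1: "(\<lambda>t. sum (w t) (S t)) \<longlonglongrightarrow> 1"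
    and inf: "infinite {t. S t = L}"
  shows "sum a L = 1"
proof (rule ccontr)
  assume L: "sum a L \<noteq> 1"
  have a: "a p \<ge> 0" for p
    using lim nonneg by (intro LIMSEQ_le_const[OF lim]) auto
  define r where "r n = (LEAST t. s n \<le> t \<and> sum a (S t) \<noteq> 1)" for n
  have "\<exists>t. s n \<le> t \<and> sum a (S t) \<noteq> 1" for n
    using inf L unfolding infinite_nat_iff_unbounded_le by auto
  then have r: "s n \<le> r n \<and> sum a (S (r n)) \<noteq> 1" for n
    unfolding r_def by (rule LeastI_ex)
  have before: "sum a (S t) = 1" if "s n \<le> t" "t < r n" for n t
    using not_less_Least[of t "\<lambda>t. s n \<le> t \<and> sum a (S t) \<noteq> 1"] that unfolding r_def by auto
  have le: "energy a (w (r n)) \<le> energy a (w (s n))" for n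
    by (rule energy_antimono) (use supp before r in auto)
  have "(\<lambda>n. energy a (w (s n))) \<longlonglongrightarrow> energy a a"
    unfolding energy_def
  proof (intro tendsto_sum)
    show "(\<lambda>n. w (s n) p - a p * ln (w (s n) p)) \<longlonglongrightarrow> a p - a p * ln (a p)" for p
      using lim[of p] by (cases "a p = 0") (auto intro!: tendsto_intros)
  qed
  then have gap0: "(\<lambda>n. energy a (w (s n)) - energy a a) \<longlonglongrightarrow> 0"
    by (simp add: LIM_zero)
  have r_lim: "(\<lambda>n. w (r n) p) \<longlonglongrightarrow> a p" for p
  proof -
    have "(sqrt (w (r n) p) - sqrt (a p))\<^sup>2 \<le> energy a (w (s n)) - energy a a" for n
    proof -
      have "(sqrt (w (r n) p) - sqrt (a p))\<^sup>2
          \<le> (\<Sum>p\<in>UNIV. (sqrt (w (r n) p) - sqrt (a p))\<^sup>2)"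
        by (rule member_le_sum) auto
      then show ?thesis
        using energy_gap[of a "w (r n)", OF a nonneg supp] le[of n] by linarith
    qed
    then have "(\<lambda>n. (sqrt (w (r n) p) - sqrt (a p))\<^sup>2) \<longlonglongrightarrow> 0"
      by (intro tendsto_sandwich[OF _ _ tendsto_const gap0] always_eventually) auto
    then have "(\<lambda>n. sqrt ((sqrt (w (r n) p) - sqrt (a p))\<^sup>2)) \<longlonglongrightarrow> sqrt 0"
      by (rule tendsto_real_sqrt)
    then have "(\<lambda>n. sqrt (w (r n) p) - sqrt (a p)) \<longlonglongrightarrow> 0"
      by (simp add: tendsto_rabs_zero_iff)
    then have "(\<lambda>n. (sqrt (w (r n) p) - sqrt (a p) + sqrt (a p))\<^sup>2) \<longlonglongrightarrow> (0 + sqrt (a p))\<^sup>2"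
      by (intro tendsto_intros)
    then show ?thesis
      using a nonneg by simp
  qed
  have "filterlim r at_top sequentially"
    by (rule filterlim_at_top_mono[OF filterlim_subseq[OF s]]) (use r in auto)
  then have r1: "(\<lambda>n. sum (w (r n)) (S (r n))) \<longlonglongrightarrow> 1"
    by (rule filterlim_compose[OF to1])
  have "(\<lambda>n. sum (w (r n)) (S (r n)) - sum a (S (r n))) \<longlonglongrightarrow> 0"
  proof (rule Lim_null_comparison)
    show "\<forall>\<^sub>F n in sequentially.
        norm (sum (w (r n)) (S (r n)) - sum a (S (r n))) \<le> (\<Sum>p\<in>UNIV. \<bar>w (r n) p - a p\<bar>)"
    proof (intro always_eventually allI)
      fix n
      have "norm (sum (w (r n)) (S (r n)) - sum a (S (r n)))
          \<le> (\<Sum>p\<in>S (r n). \<bar>w (r n) p - a p\<bar>)"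
        unfolding sum_subtractf[symmetric] real_norm_def by (rule sum_abs)
      also have "\<dots> \<le> (\<Sum>p\<in>UNIV. \<bar>w (r n) p - a p\<bar>)"
        by (intro sum_mono2) auto
      finally show "norm (sum (w (r n)) (S (r n)) - sum a (S (r n)))
          \<le> (\<Sum>p\<in>UNIV. \<bar>w (r n) p - a p\<bar>)" .
    qed
    show "(\<lambda>n. \<Sum>p\<in>UNIV. \<bar>w (r n) p - a p\<bar>) \<longlonglongrightarrow> 0"
      by (intro tendsto_null_sum tendsto_rabs_zero LIM_zero r_lim)
  qed
  from tendsto_diff[OF r1 this] have to_1: "(\<lambda>n. sum a (S (r n))) \<longlonglongrightarrow> 1"
    by simp
  \<comment> \<open>There are only finitely many sets of positions, hence finitely many values of \<open>sum a\<close>, so a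
    sequence of such values can only tend to 1 by reaching 1.\<close>
  have "closed (sum a ` {X. sum a X \<noteq> 1})"
    by (intro finite_imp_closed finite_imageI finite)
  then have "1 \<in> sum a ` {X. sum a X \<noteq> 1}"
    by (rule closed_sequentially[OF _ _ to_1]) (intro imageI CollectI conjunct2[OF r])
  then show False by auto
qed

end

section \<open>Integral points of the line polytope\<close>

fun line :: "kind \<times> 'n \<Rightarrow> ('n \<times> 'n) set" where
  "line (Row, m) = {m} \<times> UNIV"
| "line (Col, m) = UNIV \<times> {m}"

lemma finite_kind_times: "finite (L :: (kind \<times> 'n::finite) set)"
proof -
  have "finite (UNIV :: kind set)"
    by (rule finite_subset[of _ "{Row, Col}"]) (auto intro: kind.exhaust)
  then show ?thesis
    by (rule finite_subset[OF _ finite_cartesian_product[OF _ finite[of UNIV]], rotated]) auto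
qed

lemma mem_line_iff: "p \<in> line k \<longleftrightarrow> k = (Row, fst p) \<or> k = (Col, snd p)"
  by (cases k rule: line.cases; cases p) auto

lemma K_diagonal_iff: "K_diagonal K D \<longleftrightarrow> (\<forall>k\<in>K. \<exists>!p. p \<in> D \<inter> line k)"
proof -
  have split: "(\<forall>k\<in>K. Q k) \<longleftrightarrow> (\<forall>m. (Row, m) \<in> K \<longrightarrow> Q (Row, m)) \<and> (\<forall>m. (Col, m) \<in> K \<longrightarrow> Q (Col, m))"
    for Q
  proof -
    have "Q k" if "k \<in> K" "\<forall>m. (Row, m) \<in> K \<longrightarrow> Q (Row, m)" "\<forall>m. (Col, m) \<in> K \<longrightarrow> Q (Col, m)" for k
      using that by (cases k rule: line.cases) auto
    then show ?thesis by blast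
  qed
  have "p \<in> D \<inter> line (Row, m) \<longleftrightarrow> p \<in> D \<and> fst p = m"
    "p \<in> D \<inter> line (Col, m) \<longleftrightarrow> p \<in> D \<and> snd p = m" for p m
    by (auto simp: mem_line_iff simp del: line.simps)
  then show ?thesis
    unfolding K_diagonal_def split by simp
qed

text \<open>
  A dimension count: the functions supported on \<open>E\<close> have dimension \<open>card E\<close>, and the vanishing of the line
  sums is orthogonality to the vectors \<open>f k\<close>, where \<open>k\<close> ranges over the set \<open>L\<close> of lines of \<open>K\<close>
  meeting \<open>E\<close>. Counting the incidences between \<open>L\<close> and \<open>E\<close> gives \<open>2 * card L \<le> 2 * card E\<close>, as each
  such line holds at least two positions and each position lies on at most two lines. Either some position
  is on fewer than two lines of \<open>L\<close> and the inequality is strict; or the \<open>f k\<close> of the rows and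
  those of the columns in \<open>L\<close> have the same sum, so they are linearly dependent. In both cases the
  \<open>f k\<close> span less than the whole space.
\<close>

lemma exists_balanced_perturbation:
  fixes E :: "('n::finite \<times> 'n) set"
  assumes "E \<noteq> {}" and on_K: "\<And>p. p \<in> E \<Longrightarrow> \<exists>k\<in>K. p \<in> line k"
    and two: "\<And>k. k \<in> K \<Longrightarrow> line k \<inter> E \<noteq> {} \<Longrightarrow> card (line k \<inter> E) \<ge> 2"
  shows "\<exists>c :: 'n \<times> 'n \<Rightarrow> real. (\<exists>p. c p \<noteq> 0) \<and> (\<forall>p. c p \<noteq> 0 \<longrightarrow> p \<in> E) \<and> (\<forall>k\<in>K. sum c (line k) = 0)"
proof -
  define ax :: "'n \<times> 'n \<Rightarrow> real ^ ('n \<times> 'n)" where "ax p = axis p 1" for p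
  define f where "f k = (\<Sum>p\<in>line k \<inter> E. ax p)" for k
  define L where "L = {k\<in>K. line k \<inter> E \<noteq> {}}"
  define h where "h p = card {k\<in>L. p \<in> line k}" for p
  have finL: "finite L" by (rule finite_kind_times)
  have inj_ax: "inj_on ax E" unfolding ax_def by (auto simp: inj_on_def axis_eq_axis)
  have "ax ` E \<subseteq> Basis" unfolding ax_def by (auto simp: Basis_vec_def)
  then have "independent (ax ` E)" by (rule independent_mono[OF independent_Basis])
  then have dimE: "dim (ax ` E) = card E"
    using inj_ax by (simp add: dim_eq_card_independent card_image)
  have double: "(\<Sum>k\<in>L. card (line k \<inter> E)) = (\<Sum>p\<in>E. h p)"
  proof -
    have "(\<Sum>k\<in>L. card (line k \<inter> E)) = (\<Sum>k\<in>L. \<Sum>p\<in>{p\<in>E. p \<in> line k}. 1)"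
      by (simp add: Int_def conj_commute)
    also have "\<dots> = (\<Sum>p\<in>E. \<Sum>k\<in>{k\<in>L. p \<in> line k}. 1)"
      by (rule sum.swap_restrict) (use finL in auto)
    finally show ?thesis by (simp add: h_def)
  qed
  have twoL: "2 * card L \<le> (\<Sum>k\<in>L. card (line k \<inter> E))"
    using sum_bounded_below[of L 2 "\<lambda>k. card (line k \<inter> E)"] two by (auto simp: L_def mult.commute)
  have hsub: "{k\<in>L. p \<in> line k} \<subseteq> {(Row, fst p), (Col, snd p)}" for p
    by (auto simp: mem_line_iff)
  have h2: "h p \<le> 2" for p
    using card_mono[OF _ hsub[of p]] by (simp add: h_def)
  have dimL: "dim (f ` L) < card E"
  proof (cases "\<forall>p\<in>E. (Row, fst p) \<in> L \<and> (Col, snd p) \<in> L")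
    case False
    then obtain q where q: "q \<in> E" "\<not> ((Row, fst q) \<in> L \<and> (Col, snd q) \<in> L)" by blast
    have "h q \<le> 1"
    proof -
      have "{k\<in>L. q \<in> line k} \<subset> {(Row, fst q), (Col, snd q)}"
        using hsub[of q] q(2) by blast
      then show ?thesis
        using psubset_card_mono[of "{(Row, fst q), (Col, snd q)}" "{k\<in>L. q \<in> line k}"] by (simp add: h_def)
    qed
    then have "(\<Sum>p\<in>E. h p) < (\<Sum>p\<in>E. 2)"
      by (intro sum_strict_mono_ex1 bexI[of _ q] ballI h2) (use q(1) in auto)
    then have "card L < card E" using double twoL by simp
    moreover have "dim (f ` L) \<le> card L"
      using dim_le_card'[of "f ` L"] card_image_le[of L f] finL by force
    ultimately show ?thesis by linarith
  next
    case True
    have "(\<Sum>p\<in>E. h p) \<le> (\<Sum>p\<in>E. 2)" by (intro sum_mono h2)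
    then have le: "card L \<le> card E" using double twoL by simp
    define LR where "LR = {k\<in>L. fst k = Row}"
    define LC where "LC = {k\<in>L. fst k = Col}"
    have total: "sum f LR = sum ax E" "sum f LC = sum ax E"
    proof -
      have "sum f M = sum ax E" if "M \<subseteq> L" and u: "\<And>p. p \<in> E \<Longrightarrow> \<exists>!k. k \<in> M \<and> p \<in> line k" for M
      proof -
        have fin: "finite M" using that(1) finL finite_subset by blast
        have "sum f M = (\<Sum>k\<in>M. \<Sum>p\<in>{p\<in>E. p \<in> line k}. ax p)"
          unfolding f_def by (intro sum.cong) auto
        also have "\<dots> = (\<Sum>p\<in>E. \<Sum>k\<in>{k\<in>M. p \<in> line k}. ax p)"
          by (rule sum.swap_restrict) (use fin in auto)
        also have "\<dots> = (\<Sum>p\<in>E. ax p)"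
        proof (rule sum.cong)
          fix p assume "p \<in> E"
          then obtain k where "{k\<in>M. p \<in> line k} = {k}" using u by blast
          then show "(\<Sum>k\<in>{k\<in>M. p \<in> line k}. ax p) = ax p" by simp
        qed simp
        finally show ?thesis .
      qed
      note * = this
      show "sum f LR = sum ax E" by (rule *) (use True in \<open>auto simp: LR_def mem_line_iff\<close>)
      show "sum f LC = sum ax E" by (rule *) (use True in \<open>auto simp: LC_def mem_line_iff\<close>)
    qed
    obtain q where q: "q \<in> E" using \<open>E \<noteq> {}\<close> by blast
    define k0 where "k0 = (Row, fst q)"
    have k0: "k0 \<in> LR" using True q by (simp add: k0_def LR_def)
    have "f k0 = sum f LC - sum f (LR - {k0})"
      using total sum.remove[OF _ k0, of f] finL by (simp add: LR_def)
    also have "\<dots> \<in> span (f ` (L - {k0}))"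
      using k0 by (intro span_diff span_sum span_base) (auto simp: LC_def LR_def)
    finally have "f k0 \<in> span (f ` (L - {k0}))" .
    moreover have "f ` L = insert (f k0) (f ` (L - {k0}))"
      using k0 by (auto simp: LR_def)
    ultimately have "span (f ` L) = span (f ` (L - {k0}))"
      by (simp add: span_redundant)
    then have "dim (f ` L) = dim (f ` (L - {k0}))"
      by (metis dim_span)
    also have "\<dots> \<le> card (L - {k0})"
      using dim_le_card'[of "f ` (L - {k0})"] card_image_le[of "L - {k0}" f] finL by force
    also have "\<dots> < card L"
      using k0 finL by (intro psubset_card_mono) (auto simp: LR_def)
    finally show ?thesis using le by linarith
  qed
  have "span (f ` L) \<subseteq> span (ax ` E)"
    unfolding f_def by (intro span_minimal image_subsetI span_sum span_base subspace_span) auto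
  moreover have "span (f ` L) \<noteq> span (ax ` E)"
    using dimL dimE by (metis dim_span less_irrefl)
  ultimately obtain x where x: "x \<noteq> 0" "x \<in> span (ax ` E)"
      and orth: "\<And>y. y \<in> span (f ` L) \<Longrightarrow> orthogonal x y"
    using orthogonal_to_subspace_exists_gen[of "f ` L" "ax ` E"] by blast
  have xE: "p \<in> E" if "x $ p \<noteq> 0" for p
  proof (rule ccontr)
    assume p: "p \<notin> E"
    have "subspace {x :: real ^ ('n \<times> 'n). x $ p = 0}" by (auto simp: subspace_def)
    moreover have "ax ` E \<subseteq> {x. x $ p = 0}" using p by (auto simp: ax_def axis_def)
    ultimately have "span (ax ` E) \<subseteq> {x. x $ p = 0}" by (rule span_minimal[rotated])
    then show False using x that by auto
  qed
  have "sum (($) x) (line k) = 0" if "k \<in> K" for k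
  proof -
    have "sum (($) x) (line k) = sum (($) x) (line k \<inter> E)"
      using xE by (intro sum.mono_neutral_right) auto
    also have "\<dots> = 0"
    proof (cases "k \<in> L")
      case True
      then have "x \<bullet> f k = 0"
        using orth[OF span_base] by (auto simp: orthogonal_def)
      then show ?thesis
        by (simp add: f_def ax_def inner_sum_right inner_axis)
    next
      case False
      then have "line k \<inter> E = {}" using that by (simp add: L_def)
      then show ?thesis by simp
    qed
    finally show ?thesis .
  qed
  moreover have "\<exists>p. x $ p \<noteq> 0" using x(1) by (auto simp: vec_eq_iff)
  ultimately show ?thesis using xE by (intro exI[of _ "($) x"]) auto
qed

text \<open>
  Move from \<open>b\<close> in direction \<open>c\<close> up to the boundary of the nonnegative orthant: \<open>e\<close> is the first time at
  which an entry reaches 0.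
\<close>

lemma support_shrinking_step:
  fixes b c :: "'p::finite \<Rightarrow> real"
  assumes b: "\<And>p. b p \<ge> 0" and c: "\<And>p. c p \<noteq> 0 \<Longrightarrow> b p > 0" and neg: "c r < 0"
  shows "\<exists>e>0. (\<forall>p. b p + e * c p \<ge> 0) \<and> {p. b p + e * c p > 0} \<subset> {p. b p > 0}"
proof -
  define P where "P = {p. c p < 0}"
  define g where "g p = b p / - c p" for p
  define e where "e = Min (g ` P)"
  have "r \<in> P" using neg by (simp add: P_def)
  then have "e \<in> g ` P" unfolding e_def by (intro Min_in) auto
  then obtain q where q: "c q < 0" "e = g q" by (auto simp: P_def)
  have le: "e \<le> g p" if "c p < 0" for p
    using that by (auto simp: e_def P_def)
  have bq: "b q > 0" using c q by auto
  have e0: "e > 0" using q bq by (simp add: g_def divide_pos_neg)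
  have "b p + e * c p \<ge> 0" for p
  proof (cases "c p < 0")
    case True
    then show ?thesis using le[OF True] by (simp add: g_def field_simps)
  next
    case False
    then show ?thesis using b e0 by simp
  qed
  moreover have "b q + e * c q = 0" using q by (simp add: g_def field_simps)
  moreover have "b p > 0" if "b p + e * c p > 0" for p
    using that c[of p] by (cases "c p = 0") auto
  ultimately show ?thesis using e0 bq by (intro exI[of _ e]) force
qed

text \<open>
  Induction on the size of the support. If every positive entry on a line of \<open>K\<close> is at least 1, then the
  support itself is a \<open>K\<close>-diagonal. Otherwise the fractional entries on lines of \<open>K\<close> come at least in
  pairs on each such line, so they carry a perturbation that preserves all line sums; moving along it
  until an entry vanishes shrinks the support. Positions outside all lines of \<open>K\<close> are left alone:
  they are unconstrained and may belong to any \<open>K\<close>-diagonal.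
\<close>

lemma positive_entry_on_K_diagonal:
  fixes b :: "'n::finite \<times> 'n \<Rightarrow> real"
  assumes "\<And>p. b p \<ge> 0" and "\<And>k. k \<in> K \<Longrightarrow> sum b (line k) = 1" and "b q > 0"
  shows "\<exists>D. K_diagonal K D \<and> q \<in> D \<and> (\<forall>p\<in>D. b p > 0)"
  using assms
proof (induction "card {p. b p > 0}" arbitrary: b rule: less_induct)
  case less
  note nonneg = less.prems(1) and one = less.prems(2)
  define E where "E = {p. 0 < b p \<and> b p < 1 \<and> (\<exists>k\<in>K. p \<in> line k)}"
  have pair_le: "b p + b p' \<le> 1" if "k \<in> K" "p \<in> line k" "p' \<in> line k" "p \<noteq> p'" for k p p'
    using sum_mono2[of "line k" "{p, p'}" b] that one nonneg by simp
  show ?case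
  proof (cases "E = {}")
    case True
    have "\<exists>!p. p \<in> {p. b p > 0} \<inter> line k" if k: "k \<in> K" for k
    proof -
      have "\<exists>p\<in>line k. b p \<noteq> 0"
        using one[OF k] by (metis sum.neutral zero_neq_one)
      then obtain p where p: "p \<in> line k" "b p > 0" using nonneg by (metis less_eq_real_def)
      have "p \<notin> E" using True by simp
      then have "b p \<ge> 1" using p k unfolding E_def by (metis (mono_tags, lifting) mem_Collect_eq not_le)
      then have "p' = p" if "p' \<in> line k" "b p' > 0" for p'
        using pair_le[OF k p(1) that(1)] that by force
      then show ?thesis using p by blast
    qed
    then show ?thesis
      using less.prems(3) by (intro exI[of _ "{p. b p > 0}"]) (auto simp: K_diagonal_iff)
  next
    case False
    have "card (line k \<inter> E) \<ge> 2" if k: "k \<in> K" and ne: "line k \<inter> E \<noteq> {}" for k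
    proof -
      obtain p where p: "p \<in> line k" "p \<in> E" using ne by blast
      have "sum b (line k - {p}) \<noteq> 0"
        using one[OF k] p sum.remove[of "line k" p b] by (simp add: E_def)
      then obtain p' where p': "p' \<in> line k" "p' \<noteq> p" "b p' > 0"
        using nonneg by (metis Diff_iff insertI1 less_eq_real_def sum.neutral)
      have "p' \<in> E"
        using pair_le[OF k p(1) p'(1)] p p' k by (auto simp: E_def)
      then show ?thesis
        using card_mono[of "line k \<inter> E" "{p, p'}"] p p' by simp
    qed
    moreover have "\<exists>k\<in>K. p \<in> line k" if "p \<in> E" for p using that by (simp add: E_def)
    ultimately have "\<exists>c :: 'n \<times> 'n \<Rightarrow> real.
        (\<exists>p. c p \<noteq> 0) \<and> (\<forall>p. c p \<noteq> 0 \<longrightarrow> p \<in> E) \<and> (\<forall>k\<in>K. sum c (line k) = 0)"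
      by (intro exists_balanced_perturbation False)
    then obtain c :: "'n \<times> 'n \<Rightarrow> real" where c: "\<exists>p. c p \<noteq> 0"
        "\<And>p. c p \<noteq> 0 \<Longrightarrow> p \<in> E" "\<And>k. k \<in> K \<Longrightarrow> sum c (line k) = 0"
      by blast
    \<comment> \<open>The sign is chosen such that the entry at \<open>q\<close> cannot be the one that vanishes.\<close>
    define d where "d p = (if c q \<ge> 0 then c p else - c p)" for p
    have d_iff: "d p \<noteq> 0 \<longleftrightarrow> c p \<noteq> 0" for p by (simp add: d_def)
    have d: "\<exists>p. d p \<noteq> 0" "\<And>p. d p \<noteq> 0 \<Longrightarrow> p \<in> E" "d q \<ge> 0"
      using c(1,2) unfolding d_iff by (blast, blast, simp add: d_def)
    have d0: "sum d (line k) = 0" if "k \<in> K" for k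
      using c(3)[OF that] by (cases "c q \<ge> 0") (simp_all add: d_def sum_negf)
    \<comment> \<open>Each position of \<open>E\<close> is on a line with \<open>d\<close>-sum 0, so a nonzero \<open>d\<close> takes both signs.\<close>
    have "\<exists>r. d r < 0"
    proof (rule ccontr)
      assume "\<nexists>r. d r < 0"
      then have ge: "d p \<ge> 0" for p by (meson not_less)
      obtain p where p: "d p \<noteq> 0" using d by blast
      then obtain k where "k \<in> K" "p \<in> line k" using d(2)[OF p] unfolding E_def by blast
      then show False
        using d0 ge p sum_nonneg_eq_0_iff[of "line k" d] by auto
    qed
    then obtain r where "d r < 0" by blast
    moreover have "b p > 0" if "d p \<noteq> 0" for p using d(2)[OF that] by (simp add: E_def)
    ultimately obtain e where e: "e > 0" "\<And>p. b p + e * d p \<ge> 0"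
        "{p. b p + e * d p > 0} \<subset> {p. b p > 0}"
      using support_shrinking_step[of b d] nonneg by blast
    have "\<exists>D. K_diagonal K D \<and> q \<in> D \<and> (\<forall>p\<in>D. b p + e * d p > 0)"
    proof (rule less.hyps)
      show "card {p. 0 < b p + e * d p} < card {p. 0 < b p}"
        using e(3) by (intro psubset_card_mono) auto
      show "(\<Sum>p\<in>line k. b p + e * d p) = 1" if "k \<in> K" for k
        using one[OF that] d0[OF that] by (simp add: sum.distrib sum_distrib_left[symmetric])
      show "b q + e * d q > 0" using less.prems(3) d(3) e(1) by (simp add: add_pos_nonneg)
    qed (use e in auto)
    then show ?thesis using e(3) by blast
  qed
qed

section \<open>Limits of diagonal scalings\<close>

text \<open>
  The factors \<open>x n\<close> and \<open>y n\<close> themselves may diverge, since only their products on \<open>E\<close> are controlled.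
  In logarithms these products are the image of a linear map, and such an image is closed in finite
  dimension.
\<close>

lemma scaling_limit:
  fixes x y :: "nat \<Rightarrow> 'n::finite \<Rightarrow> real" and r :: "'n \<times> 'n \<Rightarrow> real"
  assumes pos: "\<And>n i. x n i > 0" "\<And>n j. y n j > 0" "\<And>p. p \<in> E \<Longrightarrow> r p > 0"
    and lim: "\<And>p. p \<in> E \<Longrightarrow> (\<lambda>n. x n (fst p) * y n (snd p)) \<longlonglongrightarrow> r p"
  shows "\<exists>u v. (\<forall>i. u i > 0) \<and> (\<forall>j. v j > 0) \<and> (\<forall>p\<in>E. u (fst p) * v (snd p) = r p)"
proof -
  define F :: "(real ^ 'n) \<times> (real ^ 'n) \<Rightarrow> real ^ ('n \<times> 'n)"
    where "F = (\<lambda>z. \<chi> p. if p \<in> E then fst z $ fst p + snd z $ snd p else 0)"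
  have "linear F"
    by (auto simp: F_def linear_iff vec_eq_iff algebra_simps)
  then have "closed (range F)"
    by (intro closed_subspace linear_subspace_image subspace_UNIV)
  define z where "z n = (\<chi> i. ln (x n i), \<chi> j. ln (y n j))" for n
  have lim_F: "(\<lambda>n. F (z n)) \<longlonglongrightarrow> (\<chi> p. if p \<in> E then ln (r p) else 0)"
  proof (rule vec_tendstoI)
    fix p
    show "(\<lambda>n. F (z n) $ p) \<longlonglongrightarrow> (\<chi> p. if p \<in> E then ln (r p) else 0) $ p"
    proof (cases "p \<in> E")
      case True
      then have "(\<lambda>n. ln (x n (fst p) * y n (snd p))) \<longlonglongrightarrow> ln (r p)"
        using pos(3)[OF True] by (intro tendsto_ln lim) auto
      then show ?thesis
        using True pos(1,2) by (simp add: F_def z_def ln_mult_pos)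
    qed (simp add: F_def)
  qed
  have "(\<chi> p. if p \<in> E then ln (r p) else 0) \<in> range F"
    by (rule closed_sequentially[OF \<open>closed (range F)\<close> _ lim_F]) (rule rangeI)
  then obtain u v where F: "(\<chi> p. if p \<in> E then ln (r p) else 0) = F (u, v)"
    by auto
  have uv: "ln (r p) = u $ fst p + v $ snd p" if "p \<in> E" for p
  proof -
    have "(\<chi> p. if p \<in> E then ln (r p) else 0) $ p = F (u, v) $ p"
      unfolding F ..
    then show ?thesis using that by (simp add: F_def)
  qed
  then have "exp (u $ fst p) * exp (v $ snd p) = r p" if "p \<in> E" for p
    using that pos(3)[OF that] by (simp flip: exp_add uv)
  then show ?thesis
    by (intro exI[of _ "\<lambda>i. exp (u $ i)"] exI[of _ "\<lambda>j. exp (v $ j)"]) simp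
qed

lemma diagonally_equivalentI:
  fixes A B :: "real ^ 'n ^ 'n"
  assumes "\<And>i. u i > 0" "\<And>j. v j > 0" "\<And>i j. A $ i $ j = u i * B $ i $ j * v j"
  shows "diagonally_equivalent A B"
proof -
  let ?D = "\<lambda>u. (\<chi> i j. if i = j then u i else 0) :: real ^ 'n ^ 'n"
  have "A = ?D u ** B ** ?D v"
    by (simp add: vec_eq_iff matrix_matrix_mult_def assms(3) if_distrib if_distribR sum.delta sum.delta' cong: if_cong)
  moreover have "positive_diagonal_matrix (?D u)" "positive_diagonal_matrix (?D v)"
    using assms by (auto simp: positive_diagonal_matrix_def)
  ultimately show ?thesis unfolding diagonally_equivalent_def by blast
qed

section \<open>The normalized sequence of a matrix\<close>

definition entry :: "real ^ 'n ^ 'n \<Rightarrow> 'n \<times> 'n \<Rightarrow> real" where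
  "entry W p = W $ fst p $ snd p"

lemma entry_normalizing_op:
  "entry (normalizing_op a m W) = normalize_on (line (a, m)) (entry W)"
proof -
  have "sum (entry W) ({m} \<times> UNIV) = (\<Sum>k\<in>UNIV. W $ m $ k)"
    "sum (entry W) (UNIV \<times> {m}) = (\<Sum>k\<in>UNIV. W $ k $ m)"
    by (simp_all add: entry_def sum.cartesian_product' case_prod_beta)
  then show ?thesis
    by (cases a) (auto simp: fun_eq_iff entry_def normalize_on_def row_normalize_def column_normalize_def)
qed

lemma line_sum_pos:
  fixes W :: "real ^ 'n ^ 'n" and w :: "'n \<times> 'n \<Rightarrow> real"
  assumes "no_null_lines W" and "\<And>p. w p \<ge> 0" and "\<And>p. entry W p \<noteq> 0 \<Longrightarrow> w p > 0"
  shows "sum w (line k) > 0"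
proof -
  obtain p where "p \<in> line k" "entry W p \<noteq> 0"
  proof (cases k rule: line.cases)
    case (1 m)
    then obtain j where "W $ m $ j \<noteq> 0"
      using assms(1) by (auto simp: no_null_lines_def row_def vec_eq_iff)
    then show ?thesis using that[of "(m, j)"] 1 by (simp add: entry_def)
  next
    case (2 m)
    then obtain i where "W $ i $ m \<noteq> 0"
      using assms(1) by (auto simp: no_null_lines_def column_def vec_eq_iff)
    then show ?thesis using that[of "(i, m)"] 2 by (simp add: entry_def)
  qed
  then show ?thesis using assms(2,3) by (intro sum_pos2[of "line k" p w] finite) auto
qed

lemma normalized_seq_scaling:
  fixes W0 :: "real ^ 'n ^ 'n"
  assumes "nonneg_matrix W0" "no_null_lines W0"
  shows "\<exists>x y. (\<forall>i. x i > 0) \<and> (\<forall>j. y j > 0) \<and>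
    (\<forall>p. entry (normalized_seq k l W0 t) p = x (fst p) * y (snd p) * entry W0 p)"
proof (induction t)
  case 0
  show ?case by (intro exI[of _ "\<lambda>_. 1"]) simp
next
  case (Suc t)
  then obtain x y where xy: "\<And>i. x i > 0" "\<And>j. y j > 0"
    "\<And>p. entry (normalized_seq k l W0 t) p = x (fst p) * y (snd p) * entry W0 p" by blast
  let ?L = "line (k (Suc t), l (Suc t))"
  let ?w = "entry (normalized_seq k l W0 t)"
  have W0: "entry W0 p \<ge> 0" for p using assms(1) by (simp add: nonneg_matrix_def entry_def)
  have s: "sum ?w ?L > 0"
  proof (rule line_sum_pos[OF assms(2)])
    show "?w p \<ge> 0" for p using xy W0 by (simp add: less_imp_le)
    show "?w p > 0" if "entry W0 p \<noteq> 0" for p using xy W0[of p] that by simp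
  qed
  have new: "entry (normalized_seq k l W0 (Suc t)) p = (if p \<in> ?L then ?w p / sum ?w ?L else ?w p)" for p
    by (simp add: entry_normalizing_op normalize_on_def)
  show ?case
  proof (cases "k (Suc t)")
    case Row
    let ?x = "\<lambda>i. if i = l (Suc t) then x i / sum ?w ?L else x i"
    show ?thesis
      by (intro exI[of _ ?x] exI[of _ y]) (use Row s xy(1,2) in \<open>simp add: new xy(3) mem_line_iff del: normalized_seq.simps\<close>)
  next
    case Col
    let ?y = "\<lambda>j. if j = l (Suc t) then y j / sum ?w ?L else y j"
    show ?thesis
      by (intro exI[of _ x] exI[of _ ?y]) (use Col s xy(1,2) in \<open>simp add: new xy(3) mem_line_iff del: normalized_seq.simps\<close>)
  qed
qed

lemma eventually_infinitely_often:
  fixes l :: "nat \<Rightarrow> 'n::finite"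
  shows "\<exists>T. \<forall>t\<ge>T. (k (Suc t), l (Suc t)) \<in> infinitely_often k l"
proof -
  have "finite (- infinitely_often k l)" by (rule finite_kind_times)
  then have "finite (\<Union>m\<in>- infinitely_often k l. {t. 1 \<le> t \<and> k t = fst m \<and> l t = snd m})"
    by (rule finite_UN_I) (auto simp: infinitely_often_def)
  then obtain T where T: "\<forall>t\<in>(\<Union>m\<in>- infinitely_often k l. {t. 1 \<le> t \<and> k t = fst m \<and> l t = snd m}). t < T"
    unfolding finite_nat_set_iff_bounded by blast
  have "(k (Suc t), l (Suc t)) \<in> infinitely_often k l" if t: "T \<le> t" for t
  proof (rule ccontr)
    assume "(k (Suc t), l (Suc t)) \<notin> infinitely_often k l"
    then have "Suc t \<in> (\<Union>m\<in>- infinitely_often k l. {t. 1 \<le> t \<and> k t = fst m \<and> l t = snd m})"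
      by (intro UN_I[of "(k (Suc t), l (Suc t))"]) auto
    then have "Suc t < T" by (rule bspec[OF T])
    then show False using t by simp
  qed
  then show ?thesis by blast
qed

theorem theorem3p7:
  fixes W0 A :: "real ^ 'n ^ 'n"
    and k :: "nat \<Rightarrow> kind"
    and l :: "nat \<Rightarrow> 'n"
  assumes "nonneg_matrix W0"
    and "no_null_lines W0"
    and "\<exists>D. K_diagonal (infinitely_often k l) D \<and> positive_for D W0"
    and "seq_limit_point (normalized_seq k l W0) A"
  shows "diagonally_equivalent A (positive_supported_part (infinitely_often k l) W0)"
proof -
  define K where "K = infinitely_often k l"
  define w where "w t = entry (normalized_seq k l W0 t)" for t
  define S where "S t = line (k (Suc t), l (Suc t))" for t
  define a where "a = entry A"
  have W0: "entry W0 p \<ge> 0" for p using assms(1) by (simp add: nonneg_matrix_def entry_def)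
  have "\<forall>t. \<exists>x y. (\<forall>i. x i > 0) \<and> (\<forall>j. y j > 0) \<and> (\<forall>p. w t p = x (fst p) * y (snd p) * entry W0 p)"
    unfolding w_def using normalized_seq_scaling[OF assms(1,2)] by blast
  then obtain x y where xy: "\<And>t i. x t i > 0" "\<And>t j. y t j > 0"
      "\<And>t p. w t p = x t (fst p) * y t (snd p) * entry W0 p"
    by metis
  have w0: "w t p \<ge> 0" for t p using xy W0 by (simp add: less_imp_le)
  have wpos: "w t p > 0" if "entry W0 p \<noteq> 0" for t p using xy W0[of p] that by simp
  interpret normalizing_sequence w S
  proof
    show "w (Suc t) = normalize_on (S t) (w t)" for t
      by (simp add: w_def S_def entry_normalizing_op)
    show "sum (w t) (S t) > 0" for t
      unfolding S_def by (rule line_sum_pos[OF assms(2) w0 wpos])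
  qed (rule w0)
  obtain T where T: "\<And>t. T \<le> t \<Longrightarrow> (k (Suc t), l (Suc t)) \<in> K"
    using eventually_infinitely_often[of k l] unfolding K_def by blast
  obtain s where s: "strict_mono s" "(normalized_seq k l W0 \<circ> s) \<longlonglongrightarrow> A"
    using assms(4) unfolding seq_limit_point_def by blast
  have lim: "(\<lambda>n. w (s n) p) \<longlonglongrightarrow> a p" for p
    using tendsto_vec_nth[OF tendsto_vec_nth[OF s(2)], of "fst p" "snd p"]
    by (simp add: w_def a_def entry_def o_def)
  have a0: "a p \<ge> 0" for p
    using LIMSEQ_le_const[OF lim] w0 by blast
  have a_supp: "entry W0 p \<noteq> 0" if "a p \<noteq> 0" for p
  proof
    assume "entry W0 p = 0"
    then have "(\<lambda>n. 0) \<longlonglongrightarrow> a p" using lim[of p] by (simp add: xy)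
    then show False using that by (simp add: LIMSEQ_const_iff)
  qed
  have pos_iff: "positive_for D W0 \<longleftrightarrow> (\<forall>p\<in>D. entry W0 p > 0)" for D
    by (auto simp: positive_for_def entry_def)
  have line_D: "sum (indicator D) (S t) = (1::real)" if D: "K_diagonal K D" and "T \<le> t" for D t
  proof -
    obtain p where "D \<inter> S t = {p}"
      using D T[OF \<open>T \<le> t\<close>] unfolding K_diagonal_iff S_def by blast
    then show ?thesis
      by (simp add: indicator_def sum.If_cases Int_commute)
  qed
  have D_supp: "w t p > 0" if "positive_for D W0" "indicator D p \<noteq> (0::real)" for D t p
  proof -
    have "entry W0 p > 0" using that by (auto simp: pos_iff indicator_def split: if_splits)
    then show ?thesis using wpos[of p t] by simp
  qed
  have line_a: "sum a (line m) = 1" if m: "m \<in> K" for m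
  proof (rule limit_point_line_sum[OF s(1) lim])
    show "w t p > 0" if "a p \<noteq> 0" for t p using wpos a_supp that by blast
    obtain D where "K_diagonal K D" "positive_for D W0" using assms(3) by (auto simp: K_def)
    then show "(\<lambda>t. sum (w t) (S t)) \<longlonglongrightarrow> 1"
      using line_sums_tendsto_1[of "indicator D" T] line_D D_supp by force
    have "infinite {t. 1 \<le> t \<and> k t = fst m \<and> l t = snd m}"
      using m by (cases m) (simp add: K_def infinitely_often_def)
    moreover have "{t. 1 \<le> t \<and> k t = fst m \<and> l t = snd m} \<subseteq> Suc ` {t. S t = line m}"
    proof
      fix t assume "t \<in> {t. 1 \<le> t \<and> k t = fst m \<and> l t = snd m}"
      then show "t \<in> Suc ` {t. S t = line m}"
        by (cases t) (auto simp: S_def)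
    qed
    ultimately show "infinite {t. S t = line m}"
      using finite_subset by blast
  qed
  define E where "E = {p. \<exists>D. K_diagonal K D \<and> positive_for D W0 \<and> p \<in> D}"
  have a_pos: "a q > 0" if q: "q \<in> E" for q
  proof -
    obtain D where D: "K_diagonal K D" "positive_for D W0" "q \<in> D" using q unfolding E_def by blast
    have "\<exists>c>0. \<forall>t\<ge>T. c \<le> w t q"
      by (rule entries_bounded_below[of "indicator D"]) (use D line_D D_supp in auto)
    then obtain c where c: "c > 0" "\<And>t. T \<le> t \<Longrightarrow> c \<le> w t q" by blast
    have "c \<le> w (s n) q" if "T \<le> n" for n
      using c(2) seq_suble[OF s(1), of n] that by force
    then have "c \<le> a q" using LIMSEQ_le_const[OF lim] by blast
    then show ?thesis using c(1) by simp
  qed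
  have a_zero: "a q = 0" if "q \<notin> E" for q
  proof (rule ccontr)
    assume "a q \<noteq> 0"
    then have "a q > 0" using a0[of q] by simp
    then obtain D where D: "K_diagonal K D" "q \<in> D" "\<And>p. p \<in> D \<Longrightarrow> a p > 0"
      using positive_entry_on_K_diagonal[of a K q] a0 line_a by blast
    have "entry W0 p > 0" if "p \<in> D" for p
      using a_supp[of p] D(3)[OF that] W0[of p] by force
    then show False using that D by (auto simp: E_def pos_iff)
  qed
  have W0E: "entry W0 p > 0" if "p \<in> E" for p using that by (auto simp: E_def pos_iff)
  have "\<exists>u v. (\<forall>i. u i > 0) \<and> (\<forall>j. v j > 0) \<and> (\<forall>p\<in>E. u (fst p) * v (snd p) = a p / entry W0 p)"
  proof (rule scaling_limit[of "\<lambda>n. x (s n)" "\<lambda>n. y (s n)"])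
    show "a p / entry W0 p > 0" if "p \<in> E" for p using a_pos W0E that by simp
    show "(\<lambda>n. x (s n) (fst p) * y (s n) (snd p)) \<longlonglongrightarrow> a p / entry W0 p" if "p \<in> E" for p
      using tendsto_divide[OF lim[of p] tendsto_const, of "entry W0 p"] W0E[OF that] by (simp add: xy)
  qed (use xy in auto)
  then obtain u v where uv: "\<And>i. u i > 0" "\<And>j. v j > 0"
      "\<And>p. p \<in> E \<Longrightarrow> u (fst p) * v (snd p) = a p / entry W0 p" by blast
  have A: "A $ i $ j = u i * positive_supported_part K W0 $ i $ j * v j" for i j
  proof (cases "(i, j) \<in> E")
    case True
    then have "positive_supported_part K W0 $ i $ j = entry W0 (i, j)"
      by (auto simp: positive_supported_part_def E_def entry_def)
    then show ?thesis
      using uv(3)[OF True] W0E[OF True] by (simp add: a_def entry_def field_simps)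
  next
    case False
    then have "positive_supported_part K W0 $ i $ j = 0"
      by (auto simp: positive_supported_part_def E_def)
    then show ?thesis using a_zero[OF False] by (simp add: a_def entry_def)
  qed
  show ?thesis
    unfolding K_def[symmetric] by (rule diagonally_equivalentI[OF uv(1,2) A])
qed

end
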